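(* For all integers $n\ge 2$, $\ell_{Triang}(n)=L_{Triang}(n)$.
   Context: The triangular lattice is the tessellation of the plane by equilateral triangles (edge to edge); two triangular cells are adjacent iff they share an edge (so each cell has $3$ neighbours). A tree-like polyiamond of size $n$ is a set of $n$ cells whose induced adjacency graph is a tree. A leaf of a tree $T$ is a vertex of degree $1$ in $T$; $n_1(T)$ denotes the number of leaves. For $n\ge 2$, $L_{Triang}(n)$ is the maximum of $n_1(T)$ over all tree-like polyiamonds $T$ of size $n$. The function $\ell_{Triang}$ is defined for integers $n\ge2$ by $\ell_{Triang}(2)=\ell_{Triang}(3)=2$ and $\ell_{Triang}(n)=\ell_{Triang}(n-2)+1$ for $n\ge 4$; equivalently $\ell_{Triang}(n)=\lfloor n/2\rfloor+1$. *)

theory Defs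
  imports "HOL-Analysis.Analysis"
begin

text \<open>
  A simple graph is given by a symmetric, irreflexive relation \<open>adj\<close>; the graph it
  induces on a vertex set \<open>V\<close> is the pair \<open>adj\<close>, \<open>V\<close>.
\<close>

definition induced_connected :: "('a \<Rightarrow> 'a \<Rightarrow> bool) \<Rightarrow> 'a set \<Rightarrow> bool" where
  "induced_connected adj V \<longleftrightarrow>
     V \<noteq> {} \<and> (\<forall>u\<in>V. \<forall>v\<in>V. (\<lambda>x y. x \<in> V \<and> y \<in> V \<and> adj x y)\<^sup>*\<^sup>* u v)"

definition induced_cycle :: "('a \<Rightarrow> 'a \<Rightarrow> bool) \<Rightarrow> 'a set \<Rightarrow> 'a list \<Rightarrow> bool" where
  "induced_cycle adj V xs \<longleftrightarrow>
     3 \<le> length xs \<and> distinct xs \<and> set xs \<subseteq> V \<and>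
     (\<forall>i<length xs. adj (xs ! i) (xs ! (Suc i mod length xs)))"
  (* A cycle of the induced graph: chords are allowed. *)

definition induced_tree :: "('a \<Rightarrow> 'a \<Rightarrow> bool) \<Rightarrow> 'a set \<Rightarrow> bool" where
  "induced_tree adj V \<longleftrightarrow> induced_connected adj V \<and> (\<nexists>xs. induced_cycle adj V xs)"

definition induced_degree :: "('a \<Rightarrow> 'a \<Rightarrow> bool) \<Rightarrow> 'a set \<Rightarrow> 'a \<Rightarrow> nat" where
  "induced_degree adj V v = card {w \<in> V. adj v w}"

definition leaf_count :: "('a \<Rightarrow> 'a \<Rightarrow> bool) \<Rightarrow> 'a set \<Rightarrow> nat" where
  "leaf_count adj V = card {v \<in> V. induced_degree adj V v = 1}"

text \<open>
  The triangular lattice with side length 1. Its lattice points are \<open>a + b\<omega>\<close> for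
  integers \<open>a\<close>, \<open>b\<close>, where \<open>\<omega> = exp (\<i>\<pi>/3)\<close>; each lattice point \<open>p\<close> contributes the upward
  triangle \<open>p, p + 1, p + \<omega>\<close> and the downward triangle \<open>p + 1, p + \<omega>, p + 1 + \<omega>\<close>.
\<close>

definition tri_omega :: complex where
  "tri_omega = cis (pi / 3)"

definition tri_point :: "int \<Rightarrow> int \<Rightarrow> complex" where
  "tri_point a b = of_int a + of_int b * tri_omega"

definition up_cell :: "int \<Rightarrow> int \<Rightarrow> complex set" where
  "up_cell a b = convex hull {tri_point a b, tri_point (a + 1) b, tri_point a (b + 1)}"

definition down_cell :: "int \<Rightarrow> int \<Rightarrow> complex set" where
  "down_cell a b =
     convex hull {tri_point (a + 1) b, tri_point a (b + 1), tri_point (a + 1) (b + 1)}"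

definition triang_cells :: "complex set set" where
  "triang_cells = {c. \<exists>a b. c = up_cell a b \<or> c = down_cell a b}"

definition triang_adj :: "complex set \<Rightarrow> complex set \<Rightarrow> bool" where
  "triang_adj c d \<longleftrightarrow> c \<noteq> d \<and> (\<exists>e. e edge_of c \<and> e edge_of d)"

definition tree_like_polyiamond :: "nat \<Rightarrow> complex set set \<Rightarrow> bool" where
  "tree_like_polyiamond n T \<longleftrightarrow>
     T \<subseteq> triang_cells \<and> finite T \<and> card T = n \<and> induced_tree triang_adj T"

text \<open>
  For \<open>n \<ge> 2\<close> the maximum is over a finite nonempty set (a row of \<open>n\<close> cells is tree-like).
\<close>

definition L_Triang :: "nat \<Rightarrow> nat" where
  "L_Triang n = Max {leaf_count triang_adj T | T. tree_like_polyiamond n T}"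

text \<open>Only the values at \<open>n \<ge> 2\<close> are meaningful; those at 0 and 1 are arbitrary.\<close>

fun ell_Triang :: "nat \<Rightarrow> nat" where
  "ell_Triang n = (if n \<le> 3 then 2 else ell_Triang (n - 2) + 1)"

declare ell_Triang.simps [simp del]

lemma ell_Triang_closed_form: "n \<ge> 2 \<Longrightarrow> ell_Triang n = n div 2 + 1"
proof (induction n rule: less_induct)
  case (less n)
  show ?case
  proof (cases "n \<le> 3")
    case True
    with less.prems have "n div 2 = 1" by linarith
    with True show ?thesis by (subst ell_Triang.simps) simp
  next
    case False
    then have "n - 2 < n" "n - 2 \<ge> 2" by linarith+
    from less.IH[OF this] have "ell_Triang (n - 2) = (n - 2) div 2 + 1" .
    moreover have "(n - 2) div 2 + 1 = n div 2" using False by linarith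
    ultimately show ?thesis
      using False by (subst ell_Triang.simps) simp
  qed
qed

end

theory Submission
  imports Defs
begin

text \<open>
  Both sides equal \<open>n div 2 + 1\<close>; only the maximum needs an argument.

  Upper bound. A cell has three edges and each of them lies in only one further cell, so a
  polyiamond \<open>T\<close> of size \<open>n\<close> with \<open>k\<close> leaves has degree sum at most \<open>k + 3 * (n - k)\<close>. A connected
  graph on \<open>n\<close> vertices has at least \<open>n - 1\<close> edges, so the degree sum is at least \<open>2 * (n - 1)\<close>.
  Together these give \<open>2 * k \<le> n + 2\<close> (\<open>leaf_count_le_of_degree_le_3\<close>).

  Lower bound. The cells of a horizontal row form an infinite path, the spine. Every cell of the
  row has its third neighbour in the row above or below, and these pendant cells are
  adjacent neither to each other nor to any other cell of the spine. A finite stretch of the spine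
  with pendants attached is therefore a caterpillar. Attaching the pendant of the
  last spine cell and prolonging the spine by one cell costs two cells and gains one leaf
  (\<open>caterpillar_extend\<close>), which is the recursion of \<open>ell_Triang\<close>; the rows of two and three
  cells start it. The tree property survives each step because a new vertex with a
  single neighbour lies on no cycle (\<open>induced_tree_insert_pendant\<close>).

  The two parts meet the geometry only through the adjacency of cells in lattice coordinates
  (\<open>triang_adj_simps\<close>). The edges of a nondegenerate triangle are the segments between its
  corners, and closed segments are equal only if their endpoints are, so deciding whether two cells
  share an edge is a comparison of integer coordinates.
\<close>

section \<open>Leaves of finite graphs\<close>

locale simple_graph =
  fixes adj :: "'a \<Rightarrow> 'a \<Rightarrow> bool"
  assumes adj_sym: "adj x y \<Longrightarrow> adj y x"
    and adj_irrefl: "\<not> adj x x"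
begin

lemma induced_connected_crossing_edge:
  assumes "induced_connected adj V" "S \<subseteq> V" "S \<noteq> {}" "S \<noteq> V"
  obtains u v where "u \<in> S" "v \<in> V - S" "adj u v"
proof -
  obtain x y where x: "x \<in> S" and y: "y \<in> V - S" using assms by blast
  let ?R = "\<lambda>x y. x \<in> V \<and> y \<in> V \<and> adj x y"
  have "?R\<^sup>*\<^sup>* x y" using assms x y unfolding induced_connected_def by blast
  then have "y \<in> S \<or> (\<exists>u\<in>S. \<exists>v\<in>V - S. adj u v)"
    by (induction rule: rtranclp_induct) (use x in auto)
  then show thesis using y that by blast
qed

lemma induced_degree_insert_other:
  assumes "\<not> adj w v"
  shows "induced_degree adj (insert v V) w = induced_degree adj V w"
  unfolding induced_degree_def by (rule arg_cong[where f = card]) (use assms in auto)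

lemma induced_degree_insert_neighbour:
  assumes "finite V" "v \<notin> V" "adj w v"
  shows "induced_degree adj (insert v V) w = Suc (induced_degree adj V w)"
proof -
  have "{x \<in> insert v V. adj w x} = insert v {x \<in> V. adj w x}" using assms by auto
  then show ?thesis using assms unfolding induced_degree_def by simp
qed

lemma induced_degree_mono:
  assumes "finite V" "S \<subseteq> V"
  shows "induced_degree adj S w \<le> induced_degree adj V w"
  unfolding induced_degree_def by (rule card_mono) (use assms in auto)

text \<open>
  A connected graph has at least \<open>card V - 1\<close> edges: growing a vertex set one vertex at a time along
  crossing edges, each new vertex brings at least one new edge, hence adds at least \<open>2\<close> to the
  degree sum. The sum is taken inside the set reached so far, which makes the
  induction go through.
\<close>

lemma induced_connected_degree_sum:
  assumes "finite V" "induced_connected adj V"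
  shows "2 * card V \<le> (\<Sum>v\<in>V. induced_degree adj V v) + 2"
proof -
  have "\<exists>S\<subseteq>V. card S = Suc k \<and> 2 * Suc k \<le> (\<Sum>v\<in>S. induced_degree adj S v) + 2"
    if "Suc k \<le> card V" for k
    using that
  proof (induction k)
    case 0
    then obtain x where "x \<in> V" by fastforce
    then show ?case by (intro exI[of _ "{x}"]) auto
  next
    case (Suc k)
    then obtain S where S: "S \<subseteq> V" "card S = Suc k"
      "2 * Suc k \<le> (\<Sum>v\<in>S. induced_degree adj S v) + 2" by auto
    have "S \<noteq> {}" "S \<noteq> V" using S Suc.prems by auto
    then obtain u v where uv: "u \<in> S" "v \<in> V - S" "adj u v"
      using induced_connected_crossing_edge[OF assms(2) S(1)] by blast
    have fS: "finite S" using S assms finite_subset by blast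
    have "(\<Sum>w\<in>S. induced_degree adj S w) + 1
        = induced_degree adj S u + 1 + (\<Sum>w\<in>S - {u}. induced_degree adj S w)"
      using fS uv by (simp add: sum.remove)
    also have "\<dots> \<le> induced_degree adj (insert v S) u
        + (\<Sum>w\<in>S - {u}. induced_degree adj (insert v S) w)"
      using fS uv
      by (intro add_mono sum_mono induced_degree_mono)
        (auto simp: induced_degree_insert_neighbour)
    also have "\<dots> = (\<Sum>w\<in>S. induced_degree adj (insert v S) w)"
      using fS uv by (simp add: sum.remove)
    finally have 1: "(\<Sum>w\<in>S. induced_degree adj S w) + 1
        \<le> (\<Sum>w\<in>S. induced_degree adj (insert v S) w)" .
    have "card {u} \<le> induced_degree adj (insert v S) v"
      unfolding induced_degree_def by (rule card_mono) (use fS uv adj_sym in auto)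
    with 1 have "2 * Suc (Suc k) \<le> (\<Sum>w\<in>insert v S. induced_degree adj (insert v S) w) + 2"
      using S uv fS by simp
    then show ?case using S uv fS by (intro exI[of _ "insert v S"]) auto
  qed
  from this[of "card V - 1"] obtain S where "S \<subseteq> V" "card S = card V"
    "2 * card V \<le> (\<Sum>v\<in>S. induced_degree adj S v) + 2"
    using assms unfolding induced_connected_def by (auto simp: card_gt_0_iff)
  then show ?thesis using card_subset_eq[OF assms(1)] by auto
qed

text \<open>
  Every non-leaf counts at most \<open>3\<close> towards a degree sum that connectedness bounds from below, so
  many leaves would leave the sum too small.
\<close>

lemma leaf_count_le_of_degree_le_3:
  assumes "finite V" "induced_connected adj V" "\<And>v. v \<in> V \<Longrightarrow> induced_degree adj V v \<le> 3"
  shows "2 * leaf_count adj V \<le> card V + 2"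
proof -
  let ?L = "{v \<in> V. induced_degree adj V v = 1}"
  have "(\<Sum>v\<in>V. induced_degree adj V v)
      = (\<Sum>v\<in>V - ?L. induced_degree adj V v) + (\<Sum>v\<in>?L. induced_degree adj V v)"
    using assms by (intro sum.subset_diff) auto
  also have "\<dots> \<le> (\<Sum>v\<in>V - ?L. 3) + (\<Sum>v\<in>?L. 1)"
    using assms by (intro add_mono sum_mono) auto
  also have "\<dots> = 3 * (card V - card ?L) + card ?L"
    using assms by (simp add: card_Diff_subset)
  finally have "2 * card V \<le> 3 * (card V - card ?L) + card ?L + 2"
    using induced_connected_degree_sum[OF assms(1,2)] by linarith
  moreover have "card ?L \<le> card V" using assms by (intro card_mono) auto
  ultimately show ?thesis unfolding leaf_count_def by linarith
qed

lemma induced_connected_insert: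
  assumes "induced_connected adj V" "u \<in> V" "adj v u"
  shows "induced_connected adj (insert v V)"
proof -
  let ?R = "\<lambda>x y. x \<in> V \<and> y \<in> V \<and> adj x y"
  let ?R' = "\<lambda>x y. x \<in> insert v V \<and> y \<in> insert v V \<and> adj x y"
  have "?R\<^sup>*\<^sup>* \<le> ?R'\<^sup>*\<^sup>*" by (rule rtranclp_mono) auto
  then have V: "?R'\<^sup>*\<^sup>* x y" if "x \<in> V" "y \<in> V" for x y
    using that assms(1) unfolding induced_connected_def by blast
  have vu: "?R'\<^sup>*\<^sup>* v u" "?R'\<^sup>*\<^sup>* u v" using assms adj_sym by blast+
  have "?R'\<^sup>*\<^sup>* x u \<and> ?R'\<^sup>*\<^sup>* u x" if "x \<in> insert v V" for x
    using that V vu assms by auto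
  then show ?thesis unfolding induced_connected_def by (meson insert_not_empty rtranclp_trans)
qed

text \<open>
  On a cycle, the predecessor and the successor of a vertex are two different neighbours of it, so
  a vertex with only one neighbour cannot close a cycle.
\<close>

lemma induced_tree_insert_pendant:
  assumes "induced_tree adj V" "v \<notin> V" "{w \<in> V. adj v w} = {u}"
  shows "induced_tree adj (insert v V)"
proof -
  have "\<not> induced_cycle adj (insert v V) xs" for xs
  proof
    assume cyc: "induced_cycle adj (insert v V) xs"
    show False
    proof (cases "v \<in> set xs")
      case False
      then have "induced_cycle adj V xs" using cyc unfolding induced_cycle_def by auto
      then show False using assms unfolding induced_tree_def by blast
    next
      case True
      let ?l = "length xs"
      have l: "3 \<le> ?l" "distinct xs" "set xs \<subseteq> insert v V"
        and step: "\<And>i. i < ?l \<Longrightarrow> adj (xs ! i) (xs ! (Suc i mod ?l))"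
        using cyc unfolding induced_cycle_def by auto
      obtain i where i: "i < ?l" "xs ! i = v" using True by (auto simp: in_set_conv_nth)
      \<comment> \<open>The cyclic successor and predecessor positions of \<open>v\<close>; length at least 3 keeps them apart.\<close>
      define j where "j = Suc i mod ?l"
      define h where "h = (if i = 0 then ?l - 1 else i - 1)"
      have j: "j = (if Suc i = ?l then 0 else Suc i)" using i unfolding j_def by auto
      have h: "Suc h mod ?l = i" using i l unfolding h_def by auto
      have jh: "j < ?l" "h < ?l" "j \<noteq> i" "h \<noteq> i" "j \<noteq> h" using i l j unfolding h_def by auto
      have "adj v (xs ! j)" using step[OF i(1)] i unfolding j_def by simp
      moreover have "adj v (xs ! h)" using step[OF jh(2)] i h adj_sym by simp
      moreover have "xs ! j \<noteq> v" "xs ! h \<noteq> v" "xs ! j \<noteq> xs ! h"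
        using jh i l nth_eq_iff_index_eq by metis+
      moreover have "xs ! j \<in> insert v V" "xs ! h \<in> insert v V" using l jh nth_mem by blast+
      ultimately have "xs ! j \<in> {w \<in> V. adj v w}" "xs ! h \<in> {w \<in> V. adj v w}" by auto
      with \<open>xs ! j \<noteq> xs ! h\<close> assms(3) show False by auto
    qed
  qed
  moreover have "induced_connected adj (insert v V)"
    using induced_connected_insert[of V u v] assms unfolding induced_tree_def by auto
  ultimately show ?thesis unfolding induced_tree_def by blast
qed

lemma induced_degree_pendant:
  assumes "{w \<in> V. adj v w} = {u}"
  shows "induced_degree adj (insert v V) v = 1"
proof -
  have "{w \<in> insert v V. adj v w} = {u}" using assms adj_irrefl by auto
  then show ?thesis unfolding induced_degree_def by simp
qed

text \<open>
  The new vertex becomes a leaf and its neighbour \<open>u\<close> is none any more. An isolated \<open>u\<close> would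
  itself become a leaf, hence the positivity of its degree.
\<close>

lemma leaf_count_insert_pendant:
  assumes "finite V" "v \<notin> V" "{w \<in> V. adj v w} = {u}" "0 < induced_degree adj V u"
  shows "leaf_count adj (insert v V)
    = (if induced_degree adj V u = 1 then leaf_count adj V else Suc (leaf_count adj V))"
proof -
  let ?L = "{w \<in> V. induced_degree adj V w = 1}"
  have u: "u \<in> V" "adj u v" using assms(3) adj_sym by auto
  have "induced_degree adj (insert v V) w = induced_degree adj V w" if "w \<in> V" "w \<noteq> u" for w
    by (rule induced_degree_insert_other) (use that assms(3) adj_sym in blast)
  moreover have "induced_degree adj (insert v V) u \<noteq> 1"
    using induced_degree_insert_neighbour[OF assms(1,2) u(2)] assms(4) by simp
  ultimately have "w \<in> insert v V \<and> induced_degree adj (insert v V) w = 1 \<longleftrightarrow>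
      w \<in> insert v (?L - {u})" for w
    using induced_degree_pendant[OF assms(3)] assms(2) u by (cases "w = u"; cases "w = v") auto
  then have "{w \<in> insert v V. induced_degree adj (insert v V) w = 1} = insert v (?L - {u})"
    by blast
  moreover have "card (insert v (?L - {u})) = Suc (card (?L - {u}))"
    using assms by simp
  moreover have "card (?L - {u}) = (if u \<in> ?L then card ?L - 1 else card ?L)"
    by (auto simp: card_Diff_singleton_if)
  moreover have "card ?L > 0" if "u \<in> ?L" using that assms(1) by (auto simp: card_gt_0_iff)
  ultimately show ?thesis using u unfolding leaf_count_def by auto
qed

end

section \<open>Adjacency in the triangular lattice\<close>

text \<open>
  The faces of a simplex are the hulls of the subsets of its corners, and the dimension of such a
  face is one less than the number of its corners, so edges come from pairs of corners.
\<close>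

lemma edge_of_triangle_iff:
  fixes A B C :: "'a::euclidean_space"
  assumes "\<not> collinear {A, B, C}"
  shows "e edge_of convex hull {A, B, C} \<longleftrightarrow>
    e \<in> {closed_segment A B, closed_segment A C, closed_segment B C}"
proof -
  have ind: "\<not> affine_dependent {A, B, C}" and dist: "A \<noteq> B" "A \<noteq> C" "B \<noteq> C"
    using assms by (auto simp: collinear_3_eq_affine_dependent)
  have dim: "aff_dim (convex hull c) = 1 \<longleftrightarrow> card c = 2" if "c \<subseteq> {A, B, C}" for c
  proof -
    have "aff_dim c = int (card c) - 1"
      using affine_independent_subset[OF ind that] by (simp add: affine_independent_iff_card)
    then show ?thesis by (simp add: aff_dim_convex_hull)
  qed
  have pairs: "c \<subseteq> {A, B, C} \<and> card c = 2 \<longleftrightarrow> c = {A, B} \<or> c = {A, C} \<or> c = {B, C}" for c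
  proof
    assume "c \<subseteq> {A, B, C} \<and> card c = 2"
    then obtain x y where c: "c = {x, y}" "x \<noteq> y" and xy: "x \<in> {A, B, C}" "y \<in> {A, B, C}"
      unfolding card_2_iff by blast
    from xy show "c = {A, B} \<or> c = {A, C} \<or> c = {B, C}"
      using c by (elim insertE emptyE) (simp_all add: insert_commute)
  qed (use dist in auto)
  have "e edge_of convex hull {A, B, C} \<longleftrightarrow>
      (\<exists>c. (c \<subseteq> {A, B, C} \<and> card c = 2) \<and> e = convex hull c)"
    unfolding edge_of_def face_of_convex_hull_affine_independent[OF ind] using dim by blast
  also have "\<dots> \<longleftrightarrow> e = convex hull {A, B} \<or> e = convex hull {A, C} \<or> e = convex hull {B, C}"
    unfolding pairs by blast
  finally show ?thesis by (simp add: segment_convex_hull)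
qed

lemma Im_tri_omega: "Im tri_omega > 0"
  unfolding tri_omega_def by (simp add: sin_gt_zero)

lemma tri_point_eq_iff [simp]: "tri_point a b = tri_point c d \<longleftrightarrow> a = c \<and> b = d"
proof
  assume eq: "tri_point a b = tri_point c d"
  then have "Im (tri_point a b) = Im (tri_point c d)" by simp
  then have "b = d" using Im_tri_omega unfolding tri_point_def by simp
  with eq show "a = c \<and> b = d" unfolding tri_point_def by simp
qed simp

text \<open>
  Seen from one corner, the other two corners of a cell lie in the directions \<open>1\<close> and \<open>\<omega>\<close>, up to a
  common sign, and \<open>\<omega>\<close> is not real.
\<close>

lemma up_cell_not_collinear:
  "\<not> collinear {tri_point a b, tri_point (a + 1) b, tri_point a (b + 1)}"
proof -
  have "tri_omega \<notin> \<real>" using Im_tri_omega by (auto simp: complex_is_Real_iff)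
  then have "\<not> collinear {0, 1, tri_omega}" by (simp add: collinear_iff_Reals)
  then have "\<not> collinear {tri_point (a + 1) b, tri_point a b, tri_point a (b + 1)}"
    by (subst collinear_3) (simp_all add: tri_point_def algebra_simps)
  then show ?thesis by (simp add: insert_commute)
qed

lemma down_cell_not_collinear:
  "\<not> collinear {tri_point (a + 1) b, tri_point a (b + 1), tri_point (a + 1) (b + 1)}"
proof -
  have "tri_omega \<notin> \<real>" using Im_tri_omega by (auto simp: complex_is_Real_iff)
  then have "\<not> collinear {0, -1, - tri_omega}" by (simp add: collinear_iff_Reals)
  then have "\<not> collinear {tri_point a (b + 1), tri_point (a + 1) (b + 1), tri_point (a + 1) b}"
    by (subst collinear_3) (simp_all add: tri_point_def algebra_simps)
  then show ?thesis by (simp add: insert_commute)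
qed

text \<open>
  The lattice edges in the directions \<open>1\<close>, \<open>\<omega>\<close> and \<open>\<omega> - 1\<close>. The last is indexed by the upward cell
  that it bounds rather than by one of its endpoints, so the cells \<open>up_cell a b\<close> and
  \<open>down_cell a b\<close> share \<open>edge_d a b\<close>.
\<close>

definition edge_h :: "int \<Rightarrow> int \<Rightarrow> complex set" where
  "edge_h a b = closed_segment (tri_point a b) (tri_point (a + 1) b)"

definition edge_v :: "int \<Rightarrow> int \<Rightarrow> complex set" where
  "edge_v a b = closed_segment (tri_point a b) (tri_point a (b + 1))"

definition edge_d :: "int \<Rightarrow> int \<Rightarrow> complex set" where
  "edge_d a b = closed_segment (tri_point (a + 1) b) (tri_point a (b + 1))"

lemma lattice_edge_eq_iff [simp]:
  "edge_h a b = edge_h c d \<longleftrightarrow> a = c \<and> b = d"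
  "edge_v a b = edge_v c d \<longleftrightarrow> a = c \<and> b = d"
  "edge_d a b = edge_d c d \<longleftrightarrow> a = c \<and> b = d"
  unfolding edge_h_def edge_v_def edge_d_def closed_segment_eq doubleton_eq_iff tri_point_eq_iff
  by auto

lemma lattice_edge_neq [simp]:
  "edge_h a b \<noteq> edge_v c d" "edge_v a b \<noteq> edge_h c d"
  "edge_h a b \<noteq> edge_d c d" "edge_d a b \<noteq> edge_h c d"
  "edge_v a b \<noteq> edge_d c d" "edge_d a b \<noteq> edge_v c d"
  unfolding edge_h_def edge_v_def edge_d_def closed_segment_eq doubleton_eq_iff tri_point_eq_iff
  by auto

lemma edge_of_up_cell_iff:
  "e edge_of up_cell a b \<longleftrightarrow> e = edge_h a b \<or> e = edge_v a b \<or> e = edge_d a b"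
  unfolding up_cell_def edge_h_def edge_v_def edge_d_def
  by (simp add: edge_of_triangle_iff[OF up_cell_not_collinear] del: closed_segment_eq)

lemma edge_of_down_cell_iff:
  "e edge_of down_cell a b \<longleftrightarrow> e = edge_d a b \<or> e = edge_v (a + 1) b \<or> e = edge_h a (b + 1)"
  unfolding down_cell_def edge_h_def edge_v_def edge_d_def
  by (simp add: edge_of_triangle_iff[OF down_cell_not_collinear] del: closed_segment_eq)

text \<open>
  As point sets, cells are told apart by their edges: two edges of one upward cell would
  force two different first coordinates on the downward cell.
\<close>

lemma up_cell_neq_down_cell: "up_cell a b \<noteq> down_cell c d"
proof
  assume eq: "up_cell a b = down_cell c d"
  have "edge_h a b edge_of down_cell c d" "edge_v a b edge_of down_cell c d"
    unfolding eq[symmetric] by (simp_all add: edge_of_up_cell_iff)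
  then have "a = c" "a = c + 1" by (simp_all add: edge_of_down_cell_iff)
  then show False by simp
qed

lemma not_triang_adj_up_up: "\<not> triang_adj (up_cell a b) (up_cell c d)"
  unfolding triang_adj_def by (auto simp: edge_of_up_cell_iff)

lemma not_triang_adj_down_down: "\<not> triang_adj (down_cell a b) (down_cell c d)"
  unfolding triang_adj_def by (auto simp: edge_of_down_cell_iff)

text \<open>
  The three alternatives correspond to a common edge in direction \<open>\<omega> - 1\<close>, \<open>\<omega>\<close> and \<open>1\<close>.
\<close>

lemma triang_adj_up_down_iff: "triang_adj (up_cell a b) (down_cell c d) \<longleftrightarrow>
    c = a \<and> d = b \<or> c = a - 1 \<and> d = b \<or> c = a \<and> d = b - 1"
proof -
  have "triang_adj (up_cell a b) (down_cell c d) \<longleftrightarrow>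
      (\<exists>e. e edge_of up_cell a b \<and> e edge_of down_cell c d)"
    by (simp add: triang_adj_def up_cell_neq_down_cell)
  also have "\<dots> \<longleftrightarrow> edge_h a b edge_of down_cell c d \<or> edge_v a b edge_of down_cell c d
      \<or> edge_d a b edge_of down_cell c d"
    unfolding edge_of_up_cell_iff by blast
  also have "\<dots> \<longleftrightarrow> a = c \<and> b = d + 1 \<or> a = c + 1 \<and> b = d \<or> a = c \<and> b = d"
    by (simp add: edge_of_down_cell_iff)
  finally show ?thesis by auto
qed

lemma triang_adj_sym: "triang_adj c d \<Longrightarrow> triang_adj d c"
  unfolding triang_adj_def by blast

lemma triang_adj_down_up_iff: "triang_adj (down_cell c d) (up_cell a b) \<longleftrightarrow>
    c = a \<and> d = b \<or> c = a - 1 \<and> d = b \<or> c = a \<and> d = b - 1"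
  using triang_adj_up_down_iff triang_adj_sym by blast

lemmas triang_adj_simps =
  not_triang_adj_up_up not_triang_adj_down_down triang_adj_up_down_iff triang_adj_down_up_iff

interpretation triang: simple_graph triang_adj
  by unfold_locales (auto simp: triang_adj_sym triang_adj_def)

lemma induced_degree_triang_le_3:
  assumes "T \<subseteq> triang_cells" "c \<in> T"
  shows "induced_degree triang_adj T c \<le> 3"
proof -
  obtain x y z where N: "{d \<in> T. triang_adj c d} \<subseteq> {x, y, z}"
  proof -
    obtain a b where "c = up_cell a b \<or> c = down_cell a b"
      using assms unfolding triang_cells_def by blast
    then show thesis
    proof
      assume c: "c = up_cell a b"
      have "{d \<in> T. triang_adj c d} \<subseteq> {down_cell a b, down_cell (a - 1) b, down_cell a (b - 1)}"
      proof
        fix d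
        assume d: "d \<in> {d \<in> T. triang_adj c d}"
        then obtain a' b' where "d = up_cell a' b' \<or> d = down_cell a' b'"
          using assms(1) unfolding triang_cells_def by blast
        then show "d \<in> {down_cell a b, down_cell (a - 1) b, down_cell a (b - 1)}"
          using d unfolding c by (elim disjE) (simp_all add: triang_adj_simps, auto)
      qed
      then show thesis by (rule that)
    next
      assume c: "c = down_cell a b"
      have "{d \<in> T. triang_adj c d} \<subseteq> {up_cell a b, up_cell (a + 1) b, up_cell a (b + 1)}"
      proof
        fix d
        assume d: "d \<in> {d \<in> T. triang_adj c d}"
        then obtain a' b' where "d = up_cell a' b' \<or> d = down_cell a' b'"
          using assms(1) unfolding triang_cells_def by blast
        then show "d \<in> {up_cell a b, up_cell (a + 1) b, up_cell a (b + 1)}"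
          using d unfolding c by (elim disjE) (simp_all add: triang_adj_simps, auto)
      qed
      then show thesis by (rule that)
    qed
  qed
  have "card {d \<in> T. triang_adj c d} \<le> card {x, y, z}" by (rule card_mono[OF _ N]) simp
  also have "\<dots> \<le> 3" by (simp add: card_insert_if)
  finally show ?thesis unfolding induced_degree_def .
qed

section \<open>Caterpillars along a row of cells\<close>

text \<open>
  Spine cells alternate between upward and downward cells of row \<open>0\<close>. The pendant of an upward
  cell lies below it, in row \<open>- 1\<close>, and that of a downward cell above it, in row \<open>1\<close>.
\<close>

definition spine :: "nat \<Rightarrow> complex set" where
  "spine j = (if even j then up_cell (int (j div 2)) 0 else down_cell (int (j div 2)) 0)"

definition pendant :: "nat \<Rightarrow> complex set" where
  "pendant j = (if even j then down_cell (int (j div 2)) (-1) else up_cell (int (j div 2)) 1)"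

lemma triang_adj_spine_spine: "triang_adj (spine i) (spine j) \<longleftrightarrow> j = Suc i \<or> i = Suc j"
  unfolding spine_def by (auto simp: triang_adj_simps elim!: evenE oddE; presburger)

lemma triang_adj_pendant_spine: "triang_adj (pendant i) (spine j) \<longleftrightarrow> i = j"
  unfolding spine_def pendant_def by (auto simp: triang_adj_simps elim!: evenE oddE; presburger)

lemma triang_adj_spine_pendant: "triang_adj (spine i) (pendant j) \<longleftrightarrow> i = j"
  by (metis triang_adj_pendant_spine triang_adj_sym)

lemma not_triang_adj_pendant_pendant: "\<not> triang_adj (pendant i) (pendant j)"
  unfolding pendant_def by (auto simp: triang_adj_simps)

lemmas caterpillar_adj_simps =
  triang_adj_spine_spine triang_adj_pendant_spine triang_adj_spine_pendant
  not_triang_adj_pendant_pendant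

text \<open>
  All these cells are distinct because their adjacencies differ, so coordinates of
  cells need not be compared again.
\<close>

lemma spine_eq_iff [simp]: "spine i = spine j \<longleftrightarrow> i = j"
  using triang_adj_pendant_spine by metis

lemma pendant_eq_iff [simp]: "pendant i = pendant j \<longleftrightarrow> i = j"
  using triang_adj_pendant_spine by metis

lemma pendant_neq_spine [simp]: "pendant i \<noteq> spine j"
  using not_triang_adj_pendant_pendant[of i j] triang_adj_spine_pendant[of j j] by auto

lemma spine_in_triang_cells: "spine j \<in> triang_cells"
  unfolding spine_def triang_cells_def by auto

lemma pendant_in_triang_cells: "pendant j \<in> triang_cells"
  unfolding pendant_def triang_cells_def by auto

text \<open>
  The invariant of the construction: \<open>T\<close> is an extremal tree of size \<open>n\<close> whose spine ends in the leaf
  \<open>spine k\<close>. No cell of \<open>T\<close> lies beyond that end, and its pendant is still free.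
\<close>

definition caterpillar :: "nat \<Rightarrow> nat \<Rightarrow> complex set set \<Rightarrow> bool" where
  "caterpillar n k T \<longleftrightarrow>
     spine k \<in> T \<and> T \<subseteq> spine ` {..k} \<union> pendant ` {..<k} \<and> card T = n \<and>
     induced_tree triang_adj T \<and> induced_degree triang_adj T (spine k) = 1 \<and>
     leaf_count triang_adj T = n div 2 + 1"

lemma caterpillar_2: "caterpillar 2 1 {spine 1, spine 0}"
proof -
  let ?T = "{spine 1, spine 0}"
  have "\<not> induced_cycle triang_adj {spine 0} xs" for xs
    using card_mono[of "{spine 0}" "set xs"]
    unfolding induced_cycle_def by (auto simp: distinct_card)
  then have single: "induced_tree triang_adj {spine 0}"
    unfolding induced_tree_def induced_connected_def by auto
  have N: "{w \<in> {spine 0}. triang_adj (spine 1) w} = {spine 0}"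
    by (auto simp: caterpillar_adj_simps)
  have tree: "induced_tree triang_adj ?T"
    by (rule triang.induced_tree_insert_pendant[OF single _ N]) simp
  have "{w \<in> ?T. triang_adj (spine 0) w} = {spine 1}"
    by (auto simp: caterpillar_adj_simps)
  then have "induced_degree triang_adj ?T (spine 0) = 1"
    unfolding induced_degree_def by simp
  moreover have deg: "induced_degree triang_adj ?T (spine 1) = 1"
    by (rule triang.induced_degree_pendant[OF N])
  ultimately have "{v \<in> ?T. induced_degree triang_adj ?T v = 1} = ?T" by blast
  then have "leaf_count triang_adj ?T = 2" unfolding leaf_count_def by simp
  with tree deg show ?thesis unfolding caterpillar_def by auto
qed

lemma caterpillar_spine_neighbours:
  assumes "caterpillar n k T"
  shows "{w \<in> T. triang_adj (spine (Suc k)) w} = {spine k}"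
  using assms unfolding caterpillar_def by (auto simp: caterpillar_adj_simps)

text \<open>
  Prolonging the spine without a pendant moves the end leaf but creates no leaf, as it must between
  sizes \<open>2\<close> and \<open>3\<close>.
\<close>

lemma caterpillar_3: "caterpillar 3 2 {spine 2, spine 1, spine 0}"
proof -
  let ?T = "{spine 1, spine 0}"
  have T: "induced_tree triang_adj ?T" "induced_degree triang_adj ?T (spine 1) = 1"
    "leaf_count triang_adj ?T = 2"
    using caterpillar_2 unfolding caterpillar_def by auto
  have N: "{w \<in> ?T. triang_adj (spine 2) w} = {spine 1}"
    using caterpillar_spine_neighbours[OF caterpillar_2] by (simp only: Suc_1)
  have "induced_tree triang_adj (insert (spine 2) ?T)"
    by (rule triang.induced_tree_insert_pendant[OF T(1) _ N]) auto
  moreover have "leaf_count triang_adj (insert (spine 2) ?T) = 2"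
    using triang.leaf_count_insert_pendant[OF _ _ N] T by simp
  moreover have "induced_degree triang_adj (insert (spine 2) ?T) (spine 2) = 1"
    by (rule triang.induced_degree_pendant[OF N])
  ultimately show ?thesis unfolding caterpillar_def by auto
qed

text \<open>
  The pendant takes over the role of the leaf \<open>spine k\<close>, which leaves the number of leaves
  unchanged; \<open>spine k\<close> then has degree \<open>2\<close>, so the next spine cell adds a leaf.
\<close>

lemma caterpillar_extend:
  assumes "caterpillar n k T"
  shows "caterpillar (n + 2) (Suc k) (insert (spine (Suc k)) (insert (pendant k) T))"
proof -
  have T: "spine k \<in> T" "T \<subseteq> spine ` {..k} \<union> pendant ` {..<k}" "card T = n"
    "induced_tree triang_adj T" "induced_degree triang_adj T (spine k) = 1"
    "leaf_count triang_adj T = n div 2 + 1"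
    using assms unfolding caterpillar_def by auto
  let ?T1 = "insert (pendant k) T"
  let ?T2 = "insert (spine (Suc k)) ?T1"
  have fin: "finite T" using T(2) finite_subset by fastforce
  have new: "pendant k \<notin> T" "spine (Suc k) \<notin> ?T1"
    using T(2) by (auto simp: pendant_neq_spine[symmetric])
  have N1: "{w \<in> T. triang_adj (pendant k) w} = {spine k}"
    using T(1,2) by (auto simp: caterpillar_adj_simps)
  have N2: "{w \<in> ?T1. triang_adj (spine (Suc k)) w} = {spine k}"
    using caterpillar_spine_neighbours[OF assms] by (auto simp: caterpillar_adj_simps)
  have "induced_tree triang_adj ?T1"
    by (rule triang.induced_tree_insert_pendant[OF T(4) new(1) N1])
  then have "induced_tree triang_adj ?T2"
    by (rule triang.induced_tree_insert_pendant[OF _ new(2) N2])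
  moreover have "leaf_count triang_adj ?T1 = n div 2 + 1"
    using triang.leaf_count_insert_pendant[OF fin new(1) N1] T(5,6) by simp
  moreover have "induced_degree triang_adj ?T1 (spine k) = 2"
    using triang.induced_degree_insert_neighbour[OF fin new(1), of "spine k"] T(5)
    by (simp add: caterpillar_adj_simps)
  ultimately have "leaf_count triang_adj ?T2 = (n + 2) div 2 + 1" "induced_tree triang_adj ?T2"
    using triang.leaf_count_insert_pendant[OF _ new(2) N2] fin by simp_all
  moreover have "induced_degree triang_adj ?T2 (spine (Suc k)) = 1"
    by (rule triang.induced_degree_pendant[OF N2])
  moreover have "card ?T2 = n + 2" using fin new T(3) by simp
  moreover have "?T2 \<subseteq> spine ` {..Suc k} \<union> pendant ` {..<Suc k}" using T(2) by fastforce
  ultimately show ?thesis unfolding caterpillar_def by blast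
qed

lemma caterpillar_exists:
  assumes "n \<ge> 2"
  shows "\<exists>k T. caterpillar n k T"
  using assms
proof (induction n rule: less_induct)
  case (less n)
  consider "n = 2" | "n = 3" | "n \<ge> 4" using less.prems by linarith
  then show ?case
  proof cases
    case 3
    then have "n - 2 < n" "n - 2 \<ge> 2" "n - 2 + 2 = n" by linarith+
    then show ?thesis using less.IH[of "n - 2"] caterpillar_extend by metis
  qed (use caterpillar_2 caterpillar_3 in blast)+
qed

lemma tree_like_polyiamond_caterpillar:
  assumes "caterpillar n k T"
  shows "tree_like_polyiamond n T"
proof -
  have "T \<subseteq> spine ` {..k} \<union> pendant ` {..<k}" using assms unfolding caterpillar_def by blast
  moreover from this have "finite T" by (rule finite_subset) simp
  ultimately show ?thesis
    using assms spine_in_triang_cells pendant_in_triang_cells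
    unfolding tree_like_polyiamond_def caterpillar_def by blast
qed

theorem theorem4p2:
  fixes n :: nat
  assumes "n \<ge> 2"
  shows "ell_Triang n = L_Triang n"
proof -
  have upper: "leaf_count triang_adj T \<le> n div 2 + 1" if "tree_like_polyiamond n T" for T
  proof -
    have "2 * leaf_count triang_adj T \<le> n + 2"
      using triang.leaf_count_le_of_degree_le_3[of T] induced_degree_triang_le_3[of T] that
      unfolding tree_like_polyiamond_def induced_tree_def by auto
    then show ?thesis by linarith
  qed
  obtain k T where "caterpillar n k T" using caterpillar_exists[OF assms] by blast
  then have T: "tree_like_polyiamond n T" "leaf_count triang_adj T = n div 2 + 1"
    using tree_like_polyiamond_caterpillar by (auto simp: caterpillar_def)
  have "L_Triang n = n div 2 + 1"
    unfolding L_Triang_def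
  proof (rule Max_eqI)
    show "finite {leaf_count triang_adj T | T. tree_like_polyiamond n T}"
      by (rule finite_subset[of _ "{..n div 2 + 1}"]) (use upper in auto)
  qed (use upper T in force)+
  then show ?thesis using ell_Triang_closed_form[OF assms] by simp
qed

end
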